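(* Let $m,n\ge 1$, and let $[\sigma]$ and $[\pi]$ be disjoint cyclic permutations (no letters in common) of lengths $m$ and $n$ respectively, with $\mathrm{cdes}([\sigma])=r$ and $\mathrm{cdes}([\pi])=s$. Suppose that the largest element among all letters of $[\sigma]$ and $[\pi]$ is in $[\sigma]$. Let $c\mathcal{S}([\sigma],[\pi])$ be the set of cyclic shuffles of $[\sigma]$ and $[\pi]$. Then for every integer $k\ge 0$, as an identity in the indeterminate $q$, $$ \sum_{\substack{[\alpha]\in c\mathcal{S}([\sigma],[\pi])\\ \mathrm{cdes}([\alpha])=k}} q^{\mathrm{maj}([\alpha])} = {m-r+s \brack k-r}{n-s+r-1 \brack k-s-1}\, q^{\mathrm{maj}([\sigma])+(k-s)(k-r)} \sum_{i\notin \mathrm{cB_d}([\pi])} q^{\mathrm{maj}(S_i([\pi]))} $$ $$ \qquad +\; {m-r+s-1 \brack k-r}{n-s+r \brack k-s}\, q^{\mathrm{maj}([\sigma])+(k-s+1)(k-r)} \sum_{i\in \mathrm{cB_d}([\pi])} q^{\mathrm{maj}(S_i([\pi]))}, $$ where in the first sum on the right $i$ ranges over the letters of $[\pi]$ that are not in $\mathrm{cB_d}([\pi])$, and in the second over the letters of $[\pi]$ that are in $\mathrm{cB_d}([\pi])$.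
   Context: A (linear) permutation of length $n$ is a sequence $\pi=\pi_1\pi_2\cdots\pi_n$ of $n$ distinct letters (positive integers, not necessarily $1,\dots,n$). Its descent set is $\mathrm{Des}(\pi)=\{1\le i\le n-1:\pi_i>\pi_{i+1}\}$, and its major index is $\mathrm{maj}(\pi)=\sum_{i\in \mathrm{Des}(\pi)} i$. A cyclic permutation $[\pi]$ of length $n$ is the equivalence class of a linear permutation $\pi=\pi_1\cdots\pi_n$ under rotation: $\pi_1\pi_2\cdots\pi_n\sim \pi_i\cdots\pi_n\pi_1\cdots\pi_{i-1}$ for all $2\le i\le n$. Write $i\in[\pi]$ to mean that $i$ is a letter of $\pi$. The members of the class are the linear permutations corresponding to $[\pi]$. The representative $\hat\pi$ of $[\pi]$ is the unique linear permutation corresponding to $[\pi]$ whose first letter is the largest letter of $[\pi]$. The cyclic major index of $[\pi]$ is $\mathrm{maj}([\pi])=\mathrm{maj}(\hat\pi)$. The cyclic descent set of a linear permutation $\pi=\pi_1\cdots\pi_n$ is $\mathrm{cDes}(\pi)=\{1\le i\le n:\pi_i>\pi_{i+1}\}$ with the convention $\pi_{n+1}=\pi_1$, and $\mathrm{cdes}(\pi)=\#\mathrm{cDes}(\pi)$. This number is invariant under rotation, so the cyclic descent number $\mathrm{cdes}([\pi])=\mathrm{cdes}(\pi)$ is well defined. The cyclic descent-bottom set of $[\pi]$ is $\mathrm{cB_d}([\pi])=\{\pi_{i+1}:\pi_i>\pi_{i+1},\ 1\le i\le n\}$ with the convention $\pi_{n+1}=\pi_1$ (a set of letters of $[\pi]$,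 independent of the chosen linear permutation). For a letter $i\in[\pi]$, $S_i([\pi])$ is the unique linear permutation corresponding to $[\pi]$ whose first letter is $i$. For disjoint cyclic permutations $[\sigma]$ of length $m$ and $[\pi]$ of length $n$, a cyclic permutation $[\alpha]$ of length $m+n$ is a cyclic shuffle of $[\sigma]$ and $[\pi]$ if both $[\sigma]$ and $[\pi]$ are circular subsequences of $[\alpha]$; that is, the letters of $[\alpha]$ are those of $[\sigma]$ together with those of $[\pi]$, deleting the letters of $[\pi]$ from $[\alpha]$ leaves $[\sigma]$, and deleting the letters of $[\sigma]$ leaves $[\pi]$. The set of cyclic shuffles is denoted $c\mathcal{S}([\sigma],[\pi])$. The Gaussian polynomial ($q$-binomial coefficient) is ${N \brack M}=\frac{(1-q^N)(1-q^{N-1})\cdots(1-q^{N-M+1})}{(1-q^M)(1-q^{M-1})\cdots(1-q)}$ for integers $0\le M\le N$ (equal to $1$ when $M=0$), with the usual convention that it is $0$ if $M<0$ or $M>N$. *)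

theory Defs
  imports
    "HOL-Computational_Algebra.Polynomial"
    "HOL-Computational_Algebra.Fraction_Field"
begin

section \<open>Linear permutations\<close>

definition linear_perm :: "nat \<Rightarrow> nat list \<Rightarrow> bool" where
  "linear_perm n w \<longleftrightarrow> length w = n \<and> distinct w \<and> (\<forall>x\<in>set w. 0 < x)"

text \<open>
  Positions are numbered from 1, so the letter at position \<open>i\<close> is \<open>w ! (i - 1)\<close>, and
  \<open>w ! (i mod length w)\<close> is the letter cyclically following it.
\<close>

definition Des :: "nat list \<Rightarrow> nat set" where
  "Des w = {i. 1 \<le> i \<and> i < length w \<and> w ! (i - 1) > w ! i}"

definition maj :: "nat list \<Rightarrow> nat" where
  "maj w = (\<Sum>i\<in>Des w. i)"

definition cDes :: "nat list \<Rightarrow> nat set" where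
  "cDes w = {i. 1 \<le> i \<and> i \<le> length w \<and> w ! (i - 1) > w ! (i mod length w)}"

definition cdes :: "nat list \<Rightarrow> nat" where
  "cdes w = card (cDes w)"

definition cBd :: "nat list \<Rightarrow> nat set" where
  "cBd w = (\<lambda>i. w ! (i mod length w)) ` cDes w"

section \<open>Cyclic permutations\<close>

definition rotation_class :: "nat list \<Rightarrow> nat list set" where
  "rotation_class w = range (\<lambda>i. rotate i w)"

definition cyclic_perm :: "nat \<Rightarrow> nat list set \<Rightarrow> bool" where
  "cyclic_perm n C \<longleftrightarrow> (\<exists>w. linear_perm n w \<and> C = rotation_class w)"

definition letters :: "nat list set \<Rightarrow> nat set" where
  "letters C = (\<Union>w\<in>C. set w)"

text \<open>The operation \<open>S\<^sub>i\<close>: the member of the class that starts with the letter \<open>i\<close>.\<close>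

definition start_at :: "nat \<Rightarrow> nat list set \<Rightarrow> nat list" where
  "start_at i C = (THE w. w \<in> C \<and> w \<noteq> [] \<and> hd w = i)"

definition cyc_rep :: "nat list set \<Rightarrow> nat list" where
  "cyc_rep C = start_at (Max (letters C)) C"

definition cyc_maj :: "nat list set \<Rightarrow> nat" where
  "cyc_maj C = maj (cyc_rep C)"

text \<open>
  The next two notions are the common value on all members of the class; that there is a
  common value is shown by \<open>cyc_cdes_rotation_class\<close> and \<open>cyc_cBd_rotation_class\<close> below.
\<close>

definition cyc_cdes :: "nat list set \<Rightarrow> nat" where
  "cyc_cdes C = the_elem (cdes ` C)"

definition cyc_cBd :: "nat list set \<Rightarrow> nat set" where
  "cyc_cBd C = the_elem (cBd ` C)"

definition delete_letters :: "nat set \<Rightarrow> nat list set \<Rightarrow> nat list set" where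
  "delete_letters X C = filter (\<lambda>x. x \<notin> X) ` C"

definition cyclic_shuffles :: "nat list set \<Rightarrow> nat list set \<Rightarrow> nat list set set" where
  "cyclic_shuffles S P =
    {A. cyclic_perm (card (letters S) + card (letters P)) A \<and>
        letters A = letters S \<union> letters P \<and>
        delete_letters (letters P) A = S \<and>
        delete_letters (letters S) A = P}"

section \<open>Gaussian polynomials\<close>

text \<open>
  Identities in the indeterminate \<open>q\<close> are stated in the field of fractions of the integer
  polynomials, where the quotient defining the Gaussian polynomial and
  powers with integer exponents make literal sense.
\<close>

definition q :: "int poly fract" where
  "q = Fract [:0, 1:] 1"

definition gauss :: "int \<Rightarrow> int \<Rightarrow> int poly fract" where
  "gauss N M =
    (if 0 \<le> M \<and> M \<le> N
     then (\<Prod>i<nat M. 1 - q ^ (nat N - i)) / (\<Prod>i<nat M. 1 - q ^ (nat M - i))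
     else 0)"

section \<open>Well-definedness\<close>

lemma bij_betw_next_pos:
  fixes n :: nat
  shows "bij_betw (\<lambda>i. i mod n + 1) {1..n} {1..n}"
proof -
  have "inj_on (\<lambda>i. i mod n + 1) {1..n}"
  proof (rule inj_onI)
    fix i j assume "i \<in> {1..n}" "j \<in> {1..n}" "i mod n + 1 = j mod n + 1"
    then show "i = j"
      by (cases "i = n"; cases "j = n") auto
  qed
  moreover have "(\<lambda>i. i mod n + 1) ` {1..n} \<subseteq> {1..n}"
    by (auto simp: Suc_le_eq)
  ultimately show ?thesis
    by (simp add: bij_betw_def endo_inj_surj)
qed

lemma cDes_rotate1_iff:
  assumes "i \<in> {1..length w}"
  shows "i \<in> cDes (rotate1 w) \<longleftrightarrow> i mod length w + 1 \<in> cDes w"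
    and "rotate1 w ! (i mod length w) = w ! ((i mod length w + 1) mod length w)"
proof -
  let ?n = "length w"
  have "0 < ?n"
    using assms by (cases w) auto
  then have n: "i mod ?n < ?n" "i - 1 < ?n" "1 \<le> i" "i \<le> ?n"
    using assms by auto
  show b: "rotate1 w ! (i mod ?n) = w ! ((i mod ?n + 1) mod ?n)"
    using n by (simp add: nth_rotate1)
  have "rotate1 w ! (i - 1) = w ! (i mod ?n)"
    using n by (simp add: nth_rotate1)
  then show "i \<in> cDes (rotate1 w) \<longleftrightarrow> i mod ?n + 1 \<in> cDes w"
    using n b by (simp add: cDes_def Suc_le_eq)
qed

lemma cDes_rotate1:
  "cDes w = (\<lambda>i. i mod length w + 1) ` cDes (rotate1 w)"
proof -
  let ?f = "\<lambda>i. i mod length w + 1"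
  have sub: "cDes v \<subseteq> {1..length v}" for v
    by (auto simp: cDes_def)
  have surj: "?f ` {1..length w} = {1..length w}"
    using bij_betw_next_pos by (simp add: bij_betw_def)
  show ?thesis
  proof (intro equalityI subsetI)
    fix j assume j: "j \<in> cDes w"
    then have "j \<in> ?f ` {1..length w}"
      using sub surj by blast
    then obtain i where "i \<in> {1..length w}" "j = ?f i"
      by blast
    then show "j \<in> ?f ` cDes (rotate1 w)"
      using j cDes_rotate1_iff(1) by blast
  next
    fix j assume "j \<in> ?f ` cDes (rotate1 w)"
    then obtain i where i: "i \<in> cDes (rotate1 w)" "j = ?f i"
      by blast
    then have "i \<in> {1..length w}"
      using sub[of "rotate1 w"] by auto
    then show "j \<in> cDes w"
      using i cDes_rotate1_iff(1) by blast
  qed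
qed

lemma cdes_rotate: "cdes (rotate k w) = cdes w"
proof (induction k)
  case (Suc k)
  have "cdes (rotate1 v) = cdes v" for v
  proof -
    have "inj_on (\<lambda>i. i mod length v + 1) (cDes (rotate1 v))"
      by (rule inj_on_subset[OF bij_betw_imp_inj_on[OF bij_betw_next_pos]])
         (auto simp: cDes_def)
    then show ?thesis
      unfolding cdes_def by (subst (2) cDes_rotate1) (simp add: card_image)
  qed
  then show ?case
    using Suc by simp
qed simp

lemma cBd_rotate: "cBd (rotate k w) = cBd w"
proof (induction k)
  case (Suc k)
  have "cBd (rotate1 v) = cBd v" for v
  proof -
    have "rotate1 v ! (i mod length v) = v ! ((i mod length v + 1) mod length v)"
      if "i \<in> cDes (rotate1 v)" for i
      using that by (intro cDes_rotate1_iff(2)) (auto simp: cDes_def)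
    then show ?thesis
      unfolding cBd_def by (subst (2) cDes_rotate1) (simp add: image_image)
  qed
  then show ?case
    using Suc by simp
qed simp

lemma cyc_cdes_rotation_class: "cyc_cdes (rotation_class w) = cdes w"
  by (simp add: cyc_cdes_def rotation_class_def image_image cdes_rotate)

lemma cyc_cBd_rotation_class: "cyc_cBd (rotation_class w) = cBd w"
  by (simp add: cyc_cBd_def rotation_class_def image_image cBd_rotate)

text \<open>In particular, sums over sets of cyclic shuffles are never sums over infinite sets.\<close>

lemma finite_cyclic_shuffles: "finite (cyclic_shuffles S P)"
proof (cases "finite (letters S \<union> letters P)")
  case True
  let ?X = "letters S \<union> letters P"
  have "cyclic_shuffles S P \<subseteq>
      rotation_class ` {w. set w \<subseteq> ?X \<and> length w = card (letters S) + card (letters P)}"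
  proof
    fix A assume A: "A \<in> cyclic_shuffles S P"
    then obtain w where w: "linear_perm (card (letters S) + card (letters P)) w"
      "A = rotation_class w"
      by (auto simp: cyclic_shuffles_def cyclic_perm_def)
    have "set w \<subseteq> letters A"
      unfolding w letters_def rotation_class_def by auto
    then show "A \<in> rotation_class `
        {w. set w \<subseteq> ?X \<and> length w = card (letters S) + card (letters P)}"
      using A w by (auto simp: cyclic_shuffles_def linear_perm_def)
  qed
  then show ?thesis
    using finite_lists_length_eq[OF True] finite_surj by blast
next
  case False
  have "finite (letters A)" if "cyclic_perm n A" for n A
    using that by (auto simp: cyclic_perm_def letters_def rotation_class_def)
  then have "cyclic_shuffles S P = {}"
    using False by (force simp: cyclic_shuffles_def)
  then show ?thesis
    by simp
qed

end

theory Submission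
  imports Defs
begin

text \<open>
  Let \<open>M\<close> be the largest letter and \<open>M # t\<close> the representative of \<open>\<sigma>\<close>. The representative of a cyclic
  shuffle is \<open>M # b\<close> where \<open>b\<close> is a linear shuffle of \<open>t\<close> with a rotation \<open>S\<^sub>i(\<pi>)\<close>, and \<open>i\<close> is unique.
  As \<open>M\<close> is maximal, \<open>M # b\<close> has cyclic descent number \<open>des b + 1\<close> and major index
  \<open>maj b + des b + 1\<close>, so everything reduces to Stanley's shuffling theorem for \<open>t\<close> and \<open>S\<^sub>i(\<pi>)\<close>.
  That theorem follows by induction on the total length once it is refined by the word from which
  the last letter of the shuffle comes: each part is again a product of two Gaussian polynomials
  times a power of \<open>q\<close>, and removing the last letter leaves instances of the q-Pascal rule.
\<close>

section \<open>Gaussian polynomials\<close>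

lemma q_power_eq: "q ^ i = Fract ([:0, 1:] ^ i) 1"
  by (induction i) (simp_all add: q_def One_fract_def)

lemma q_nonzero [simp]: "q \<noteq> 0"
  by (simp add: q_def Zero_fract_def eq_fract)

text \<open>The two sides have different degrees as polynomials. Hence all q-factorials are nonzero
  and can be divided by.\<close>

lemma q_power_neq_1: "q ^ Suc i \<noteq> 1"
proof
  assume "q ^ Suc i = 1"
  then have "[:0, 1:] ^ Suc i = (1 :: int poly)"
    unfolding q_power_eq by (simp add: One_fract_def eq_fract del: power_Suc)
  then have "degree ([:0, 1:] ^ Suc i :: int poly) = 0"
    by simp
  then show False
    by (simp add: degree_power_eq del: power_Suc)
qed

lemma q_powi_add: "q powi (a + b) = q powi a * q powi b"
  by (simp add: power_int_add)

definition qfact :: "nat \<Rightarrow> int poly fract" where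
  "qfact n = (\<Prod>i<n. 1 - q ^ Suc i)"

lemma qfact_Suc: "qfact (Suc n) = qfact n * (1 - q ^ Suc n)"
  by (simp add: qfact_def)

lemma qfact_nonzero [simp]: "qfact n \<noteq> 0"
  using q_power_neq_1 by (auto simp: qfact_def simp del: power_Suc)

text \<open>Turns the falling product in \<open>gauss\<close> into a quotient of q-factorials, in a
  form free of division.\<close>

lemma prod_qfact: "M \<le> N \<Longrightarrow> (\<Prod>i<M. 1 - q ^ (N - i)) * qfact (N - M) = qfact N"
proof (induction M)
  case (Suc M)
  then have "N - M = Suc (N - Suc M)"
    by simp
  then have "qfact (N - M) = (1 - q ^ (N - M)) * qfact (N - Suc M)"
    by (simp add: qfact_Suc)
  then show ?case
    using Suc by (simp add: mult.assoc)
qed simp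

lemma gauss_of_nat:
  assumes "M \<le> N"
  shows "gauss (int N) (int M) = qfact N / (qfact M * qfact (N - M))"
proof -
  have "qfact M = (\<Prod>i<M. 1 - q ^ (M - i))"
    using prod_qfact[of M M] by (simp add: qfact_def)
  then show ?thesis
    using assms prod_qfact[OF assms] by (simp add: gauss_def divide_simps)
qed

lemma gauss_eq_0: "M < 0 \<or> N < M \<Longrightarrow> gauss N M = 0"
  by (auto simp: gauss_def)

lemma gauss_0 [simp]: "0 \<le> N \<Longrightarrow> gauss N 0 = 1"
  by (simp add: gauss_def)

lemma gauss_self [simp]: "0 \<le> N \<Longrightarrow> gauss N N = 1"
  using gauss_of_nat[of "nat N" "nat N"] qfact_nonzero[of "nat N"] by (simp add: qfact_def[of 0])

text \<open>For \<open>N = K = 0\<close> the left side is 1 but the right side is 0.\<close>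

lemma gauss_Pascal:
  assumes "1 \<le> N"
  shows "gauss N K = gauss (N - 1) K + q powi (N - K) * gauss (N - 1) (K - 1)"
proof -
  consider "K < 0 \<or> N < K" | "K = 0" | "K = N" | "1 \<le> K" "K < N"
    by linarith
  then show ?thesis
  proof cases
    case 4
    define a b where "a = nat (K - 1)" and "b = nat (N - K - 1)"
    have eq: "N = int (a + b + 2)" "N - 1 = int (a + b + 1)" "K = int (a + 1)" "K - 1 = int a"
        "N - K = int (b + 1)"
      using 4 by (simp_all add: a_def b_def)
    have [simp]: "(1 - q ^ Suc i) \<noteq> 0" for i
      using q_power_neq_1[of i] by (simp del: power_Suc)
    have "gauss N K = qfact (a + b + 2) / (qfact (a + 1) * qfact (b + 1))"
      unfolding eq by (subst gauss_of_nat) simp_all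
    moreover have "gauss (N - 1) K = qfact (a + b + 1) / (qfact (a + 1) * qfact b)"
      unfolding eq(2) unfolding eq by (subst gauss_of_nat) simp_all
    moreover have "gauss (N - 1) (K - 1) = qfact (a + b + 1) / (qfact a * qfact (b + 1))"
      unfolding eq(2,4) by (subst gauss_of_nat) simp_all
    moreover have "q powi (N - K) = q ^ Suc b"
      unfolding eq(5) power_int_of_nat by simp
    moreover have "qfact (a + b + 2) = qfact (a + b + 1) * (1 - q ^ Suc a * q ^ Suc b)"
      using qfact_Suc[of "a + b + 1"] by (simp add: power_add)
    \<comment> \<open>Applied with \<open>x = q ^ Suc a\<close> and \<open>y = q ^ Suc b\<close>;
      the rule comes down to \<open>1 - x * y = (1 - y) + y * (1 - x)\<close>.\<close>
    moreover have "F * (1 - x * y) / (A * (1 - x) * (B * (1 - y))) =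
        F / (A * (1 - x) * B) + y * (F / (A * (B * (1 - y))))"
      if "A \<noteq> 0" "B \<noteq> 0" "1 - x \<noteq> 0" "1 - y \<noteq> 0" for F A B x y :: "int poly fract"
      using that by (simp add: divide_simps del: right_minus_eq) (simp add: algebra_simps)
    ultimately show ?thesis
      by (simp add: qfact_Suc del: power_Suc right_minus_eq)
  qed (use assms in \<open>auto simp: gauss_eq_0\<close>)
qed

section \<open>Descents\<close>

abbreviation des :: "nat list \<Rightarrow> nat" where
  "des w \<equiv> card (Des w)"

lemma finite_Des [simp]: "finite (Des w)"
  by (rule finite_subset[of _ "{..length w}"]) (auto simp: Des_def)

lemma Des_Nil [simp]: "Des [] = {}"
  by (simp add: Des_def)

lemma maj_Nil [simp]: "maj [] = 0"
  by (simp add: maj_def)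

lemma Des_singleton [simp]: "Des [x] = {}"
  by (simp add: Des_def)

lemma maj_singleton [simp]: "maj [x] = 0"
  by (simp add: maj_def)

lemma Des_snoc:
  "Des (w @ [x]) = Des w \<union> (if w \<noteq> [] \<and> x < last w then {length w} else {})"
proof (rule set_eqI)
  fix i
  show "i \<in> Des (w @ [x]) \<longleftrightarrow>
      i \<in> Des w \<union> (if w \<noteq> [] \<and> x < last w then {length w} else {})"
    by (cases "w = []"; cases "i < length w"; cases "i = length w")
       (auto simp: Des_def nth_append last_conv_nth Suc_le_eq)
qed

lemma length_notin_Des [simp]: "length w \<notin> Des w"
  by (simp add: Des_def)

lemma des_snoc: "des (w @ [x]) = des w + (if w \<noteq> [] \<and> x < last w then 1 else 0)"
  by (simp add: Des_snoc)

lemma maj_snoc: "maj (w @ [x]) = maj w + (if w \<noteq> [] \<and> x < last w then length w else 0)"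
  by (simp add: maj_def Des_snoc)

lemma Des_Cons:
  assumes "w \<noteq> []" "hd w < x"
  shows "Des (x # w) = insert 1 (Suc ` Des w)"
proof (rule set_eqI)
  fix i
  show "i \<in> Des (x # w) \<longleftrightarrow> i \<in> insert 1 (Suc ` Des w)"
    using assms
    by (cases i; cases "i - 1") (auto simp: Des_def hd_conv_nth image_iff nth_Cons split: nat.splits)
qed

lemma zero_notin_Des [simp]: "0 \<notin> Des w"
  by (simp add: Des_def)

lemma des_Cons: "w \<noteq> [] \<Longrightarrow> hd w < x \<Longrightarrow> des (x # w) = Suc (des w)"
  by (subst Des_Cons) (auto simp: card_image card_insert_if)

text \<open>Each old descent moves one place to the right, which adds \<open>des w\<close>; the new
  descent at position 1 adds 1.\<close>

lemma maj_Cons: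
  assumes "w \<noteq> []" "hd w < x"
  shows "maj (x # w) = maj w + des w + 1"
proof -
  have "maj (x # w) = 1 + (\<Sum>i\<in>Suc ` Des w. i)"
    unfolding maj_def Des_Cons[OF assms] by (subst sum.insert) auto
  moreover have "(\<Sum>i\<in>Suc ` Des w. i) = (\<Sum>i\<in>Des w. i + 1)"
    by (simp add: sum.reindex)
  ultimately show ?thesis
    by (simp only: sum.distrib maj_def) simp
qed

lemma des_less_length: "w \<noteq> [] \<Longrightarrow> des w < length w"
proof -
  assume "w \<noteq> []"
  then have "card {1..<length w} < length w"
    by simp
  moreover have "des w \<le> card {1..<length w}"
    by (rule card_mono) (auto simp: Des_def)
  ultimately show ?thesis
    by linarith
qed

lemma des_le_length: "des w \<le> length w"
  using des_less_length[of w] by (cases "w = []") auto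

lemma cDes_eq:
  "cDes w = Des w \<union> (if w \<noteq> [] \<and> hd w < last w then {length w} else {})"
proof (rule set_eqI)
  fix i
  show "i \<in> cDes w \<longleftrightarrow> i \<in> Des w \<union> (if w \<noteq> [] \<and> hd w < last w then {length w} else {})"
    by (cases "w = []"; cases "i < length w") (auto simp: Des_def cDes_def hd_conv_nth last_conv_nth)
qed

lemma cdes_eq: "cdes w = des w + (if w \<noteq> [] \<and> hd w < last w then 1 else 0)"
  by (simp add: cdes_def cDes_eq)

text \<open>Only the last position has the first letter as its cyclic successor. So the rotation
  starting at a letter shows by its two ends whether that letter is a cyclic descent bottom.\<close>

lemma hd_in_cBd_iff:
  assumes "distinct w" "w \<noteq> []"
  shows "hd w \<in> cBd w \<longleftrightarrow> hd w < last w"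
proof
  assume "hd w \<in> cBd w"
  then obtain i where i: "i \<in> cDes w" "w ! 0 = w ! (i mod length w)"
    using assms by (auto simp: cBd_def hd_conv_nth)
  then have "i mod length w = 0"
    using assms by (subst (asm) nth_eq_iff_index_eq) auto
  then have "i = length w"
    using i(1) by (cases "i = length w") (auto simp: cDes_def)
  then show "hd w < last w"
    using i(1) by (simp add: cDes_eq split: if_splits)
next
  assume "hd w < last w"
  then have "length w \<in> cDes w"
    using assms by (simp add: cDes_eq)
  then show "hd w \<in> cBd w"
    using assms by (auto simp: cBd_def hd_conv_nth intro!: image_eqI[of _ _ "length w"])
qed

section \<open>The shuffle theorem for linear permutations\<close>

lemma snoc_in_shuffles_leftI: "w \<in> shuffles xs ys \<Longrightarrow> w @ [x] \<in> shuffles (xs @ [x]) ys"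
proof (induction w arbitrary: xs ys)
  case (Cons a w)
  from Cons.prems consider "xs \<noteq> []" "hd xs = a" "w \<in> shuffles (tl xs) ys"
    | "ys \<noteq> []" "hd ys = a" "w \<in> shuffles xs (tl ys)"
    unfolding Cons_in_shuffles_iff by blast
  then show ?case
  proof cases
    case 1
    then show ?thesis
      using Cons.IH[OF 1(3)] by (simp add: Cons_in_shuffles_iff)
  next
    case 2
    then show ?thesis
      using Cons.IH[OF 2(3)] by (simp add: Cons_in_shuffles_iff)
  qed
qed simp

text \<open>Reversal carries the rule \<open>Cons_in_shuffles_iff\<close> for the first letter over
  to the last letter, which the induction removes.\<close>

lemma rev_in_shuffles: "w \<in> shuffles xs ys \<Longrightarrow> rev w \<in> shuffles (rev xs) (rev ys)"
proof (induction w arbitrary: xs ys)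
  case (Cons a w)
  from Cons.prems consider "xs \<noteq> []" "hd xs = a" "w \<in> shuffles (tl xs) ys"
    | "ys \<noteq> []" "hd ys = a" "w \<in> shuffles xs (tl ys)"
    unfolding Cons_in_shuffles_iff by blast
  then show ?case
  proof cases
    case 1
    then show ?thesis
      using snoc_in_shuffles_leftI[OF Cons.IH[OF 1(3)], of a] by (cases xs) simp_all
  next
    case 2
    then show ?thesis
      using snoc_in_shuffles_leftI[of "rev w" "rev (tl ys)" "rev xs" a] Cons.IH[OF 2(3)]
      by (cases ys) (simp_all add: shuffles_commutes)
  qed
qed simp

lemma rev_in_shuffles_iff: "rev w \<in> shuffles (rev xs) (rev ys) \<longleftrightarrow> w \<in> shuffles xs ys"
  using rev_in_shuffles[of w xs ys] rev_in_shuffles[of "rev w" "rev xs" "rev ys"] by auto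

lemma snoc_in_shuffles_iff:
  "w @ [z] \<in> shuffles xs ys \<longleftrightarrow>
    (xs \<noteq> [] \<and> last xs = z \<and> w \<in> shuffles (butlast xs) ys \<or>
     ys \<noteq> [] \<and> last ys = z \<and> w \<in> shuffles xs (butlast ys))"
proof -
  have "tl (rev zs) = rev (butlast zs)" for zs :: "'a list"
    by (cases zs rule: rev_cases) simp_all
  then show ?thesis
    using rev_in_shuffles_iff[of "w @ [z]" xs ys]
    by (simp add: Cons_in_shuffles_iff hd_rev rev_in_shuffles_iff)
qed

section \<open>Generating functions by descent number and major index\<close>

text \<open>The index is an integer so that recursions may pass to \<open>k - 1\<close> freely; at
  negative \<open>k\<close> the sum is empty.\<close>

definition gf :: "nat list set \<Rightarrow> int \<Rightarrow> int poly fract" where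
  "gf A k = (\<Sum>w | w \<in> A \<and> int (des w) = k. q ^ maj w)"

definition shuffles_last :: "nat list \<Rightarrow> nat list \<Rightarrow> nat list set" where
  "shuffles_last xs ys = {w \<in> shuffles xs ys. w \<noteq> [] \<and> last w \<in> set xs}"

lemma gf_empty [simp]: "gf {} k = 0"
  by (simp add: gf_def)

lemma gf_singleton: "gf {w} k = (if int (des w) = k then q ^ maj w else 0)"
proof -
  have "{v. v \<in> {w} \<and> int (des v) = k} = (if int (des w) = k then {w} else {})"
    by auto
  then show ?thesis
    by (simp add: gf_def)
qed

lemma gf_Un:
  assumes "finite A" "finite B" "A \<inter> B = {}"
  shows "gf (A \<union> B) k = gf A k + gf B k"
proof -
  have "{w. w \<in> A \<union> B \<and> int (des w) = k} =
      {w. w \<in> A \<and> int (des w) = k} \<union> {w. w \<in> B \<and> int (des w) = k}"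
    by auto
  then show ?thesis
    unfolding gf_def using assms by (simp only:) (subst sum.union_disjoint, auto)
qed

lemma finite_shuffles_last [simp]: "finite (shuffles_last xs ys)"
  by (simp add: shuffles_last_def)

lemma shuffles_last_Nil [simp]: "shuffles_last [] ys = {}"
  by (auto simp: shuffles_last_def)

text \<open>\<open>d\<close> records whether \<open>x\<close> closes a descent, which must be the
  same throughout \<open>A\<close>; that descent sits at position \<open>l\<close>, hence the
  factor.\<close>

lemma gf_snoc:
  assumes "\<And>w. w \<in> A \<Longrightarrow> w \<noteq> [] \<and> length w = l \<and> (x < last w \<longleftrightarrow> d)"
  shows "gf ((\<lambda>w. w @ [x]) ` A) k = (if d then q powi l * gf A (k - 1) else gf A k)"
proof -
  have "{w. w \<in> (\<lambda>w. w @ [x]) ` A \<and> int (des w) = k} =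
      (\<lambda>w. w @ [x]) ` {w. w \<in> A \<and> int (des w) = (if d then k - 1 else k)}"
    using assms by (auto simp: des_snoc)
  then have "gf ((\<lambda>w. w @ [x]) ` A) k =
      (\<Sum>w | w \<in> A \<and> int (des w) = (if d then k - 1 else k). q ^ maj (w @ [x]))"
    unfolding gf_def by (simp only:) (subst sum.reindex, auto intro: inj_onI)
  also have "\<dots> = (\<Sum>w | w \<in> A \<and> int (des w) = (if d then k - 1 else k).
      (if d then q ^ l else 1) * q ^ maj w)"
    by (rule sum.cong) (use assms in \<open>auto simp: maj_snoc power_add\<close>)
  finally show ?thesis
    by (simp add: gf_def sum_distrib_left)
qed

lemma shuffles_split:
  assumes "xs \<noteq> [] \<or> ys \<noteq> []"
  shows "shuffles xs ys = shuffles_last xs ys \<union> shuffles_last ys xs"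
proof -
  have "w \<noteq> [] \<and> (last w \<in> set xs \<or> last w \<in> set ys)" if "w \<in> shuffles xs ys" for w
  proof
    show "w \<noteq> []"
      using that assms by (metis Nil_in_shuffles)
    then show "last w \<in> set xs \<or> last w \<in> set ys"
      using set_shuffles[OF that] last_in_set by blast
  qed
  then show ?thesis
    unfolding shuffles_last_def shuffles_commutes[of ys xs] by blast
qed

lemma gf_shuffles_split:
  assumes "xs \<noteq> [] \<or> ys \<noteq> []" "set xs \<inter> set ys = {}"
  shows "gf (shuffles xs ys) k = gf (shuffles_last xs ys) k + gf (shuffles_last ys xs) k"
  unfolding shuffles_split[OF assms(1)]
  using assms by (intro gf_Un) (auto simp: shuffles_last_def)

lemma shuffles_last_snoc:
  assumes "set (xs @ [x]) \<inter> set ys = {}"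
  shows "shuffles_last (xs @ [x]) ys = (\<lambda>w. w @ [x]) ` shuffles xs ys"
proof -
  have "w \<in> shuffles_last (xs @ [x]) ys \<longleftrightarrow> w \<in> (\<lambda>w. w @ [x]) ` shuffles xs ys" for w
  proof (cases w rule: rev_cases)
    case (snoc v z)
    then show ?thesis
      using assms last_in_set[of ys] by (auto simp: shuffles_last_def snoc_in_shuffles_iff)
  qed (auto simp: shuffles_last_def)
  then show ?thesis
    by blast
qed

text \<open>The point of refining by origin: within each part the last letter is constant, as
  \<open>gf_snoc\<close> requires.\<close>

lemma last_shuffles_last:
  assumes "w \<in> shuffles_last xs ys" "set xs \<inter> set ys = {}"
  shows "xs \<noteq> [] \<and> w \<noteq> [] \<and> last w = last xs"
  using assms last_in_set[of ys]
  by (cases w rule: rev_cases) (auto simp: shuffles_last_def snoc_in_shuffles_iff)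

text \<open>Deleting the final \<open>x\<close> leaves a shuffle ending in \<open>last xs\<close> or
  in \<open>last ys\<close>, and whether \<open>x\<close> closed a descent depends only on which.
  The second assumption keeps out the empty shuffle, which has no last letter.\<close>

lemma gf_shuffles_last_snoc:
  assumes "set (xs @ [x]) \<inter> set ys = {}" "xs \<noteq> [] \<or> ys \<noteq> []"
  defines "l \<equiv> int (length xs + length ys)"
  shows "gf (shuffles_last (xs @ [x]) ys) k =
      (if xs \<noteq> [] \<and> x < last xs then q powi l * gf (shuffles_last xs ys) (k - 1)
       else gf (shuffles_last xs ys) k) +
      (if ys \<noteq> [] \<and> x < last ys then q powi l * gf (shuffles_last ys xs) (k - 1)
       else gf (shuffles_last ys xs) k)"
proof -
  let ?f = "\<lambda>w. w @ [x]"
  have disj: "set xs \<inter> set ys = {}"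
    using assms by auto
  then have disj': "set ys \<inter> set xs = {}"
    by auto
  have len: "length w = length xs + length ys"
    if "w \<in> shuffles_last xs ys \<union> shuffles_last ys xs" for w
    using that shuffles_split[OF assms(2)] length_shuffles[of w xs ys] by blast
  have "gf (shuffles_last (xs @ [x]) ys) k =
      gf (?f ` shuffles_last xs ys) k + gf (?f ` shuffles_last ys xs) k"
    unfolding shuffles_last_snoc[OF assms(1)] shuffles_split[OF assms(2)] image_Un
    using disj by (intro gf_Un) (auto simp: shuffles_last_def)
  moreover have "gf (?f ` shuffles_last xs ys) k =
      (if xs \<noteq> [] \<and> x < last xs then q powi l * gf (shuffles_last xs ys) (k - 1)
       else gf (shuffles_last xs ys) k)"
    unfolding l_def using last_shuffles_last[OF _ disj] len by (intro gf_snoc) auto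
  moreover have "gf (?f ` shuffles_last ys xs) k =
      (if ys \<noteq> [] \<and> x < last ys then q powi l * gf (shuffles_last ys xs) (k - 1)
       else gf (shuffles_last ys xs) k)"
    unfolding l_def using last_shuffles_last[of _ ys xs, OF _ disj'] len by (intro gf_snoc) auto
  ultimately show ?thesis
    by simp
qed

section \<open>Recurrences of the Gaussian products\<close>

text \<open>
  The three families of Gaussian products below are the generating functions, up to the factor
  \<open>q powi (maj xs + maj ys)\<close>, of all shuffles, and of those whose last letter comes from
  \<open>xs\<close> and from \<open>ys\<close> respectively when \<open>last xs < last ys\<close>.
\<close>

definition gp :: "int \<Rightarrow> int \<Rightarrow> int \<Rightarrow> int \<Rightarrow> int \<Rightarrow> int poly fract" where
  "gp m r n s k = q powi ((k - s) * (k - r)) * gauss (m - r + s) (k - r) * gauss (n - s + r) (k - s)"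

definition gp_small :: "int \<Rightarrow> int \<Rightarrow> int \<Rightarrow> int \<Rightarrow> int \<Rightarrow> int poly fract" where
  "gp_small m r n s k = q powi (n + (k - s - 1) * (k - r)) *
     gauss (m - r + s) (k - r) * gauss (n - s + r - 1) (k - s - 1)"

definition gp_large :: "int \<Rightarrow> int \<Rightarrow> int \<Rightarrow> int \<Rightarrow> int \<Rightarrow> int poly fract" where
  "gp_large m r n s k = q powi ((k - s) * (k - r)) *
     gauss (m - r + s) (k - r) * gauss (n - s + r - 1) (k - s)"

lemma gp_commute: "gp m r n s k = gp n s m r k"
  by (simp add: gp_def mult_ac)

lemma gp_zero: "gp 0 0 0 0 k = (if k = 0 then 1 else 0)"
  by (auto simp: gp_def gauss_def)

text \<open>Pascal's rule for the second Gaussian factor; its power of q turns the exponent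
  \<open>(k - s) * (k - r)\<close> into that of \<open>gp_small\<close>.\<close>

lemma gp_split:
  assumes "1 \<le> n - s + r"
  shows "gp_small m r n s k + gp_large m r n s k = gp m r n s k"
proof -
  have "gauss (n - s + r) (k - s) = gauss (n - s + r - 1) (k - s) +
      q powi (n - s + r - (k - s)) * gauss (n - s + r - 1) (k - s - 1)"
    by (rule gauss_Pascal[OF assms])
  moreover have "q powi (n + (k - s - 1) * (k - r)) =
      q powi ((k - s) * (k - r)) * q powi (n - s + r - (k - s))"
    unfolding q_powi_add[symmetric] by (rule arg_cong[of _ _ "(powi) q"]) (simp add: algebra_simps)
  ultimately show ?thesis
    by (simp add: gp_small_def gp_large_def gp_def algebra_simps)
qed

text \<open>This and the next three lemmas mirror the deletion of the final letter:
  \<open>small\<close> and \<open>large\<close> name the word it comes from, \<open>desc\<close> and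
  \<open>asc\<close> say whether it closes a descent there. Here that descent already raises
  \<open>maj xs\<close> by \<open>m\<close>, so of the weight \<open>q powi (m + n)\<close> only
  \<open>q powi n\<close> remains.\<close>

lemma gp_small_desc: "gp_small (m + 1) (r + 1) n s k = q powi n * gp m r n s (k - 1)"
proof -
  have "m + 1 - (r + 1) + s = m - r + s" "n - s + (r + 1) - 1 = n - s + r"
      "k - (r + 1) = k - 1 - r" "k - s - 1 = k - 1 - s"
    by simp_all
  then show ?thesis
    by (simp only: gp_small_def gp_def q_powi_add mult.assoc)
qed

text \<open>Pascal's rule for the first factor. The two terms are the shuffles in which the deleted
  letter followed a letter of \<open>xs\<close> (an ascent) or of \<open>ys\<close> (a
  descent).\<close>

lemma gp_small_asc:
  assumes "0 \<le> m - r + s"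
  shows "gp_small (m + 1) r n s k = gp_small m r n s k + q powi (m + n) * gp_large m r n s (k - 1)"
proof -
  have "gauss (m - r + s + 1) (k - r) = gauss (m - r + s) (k - r) +
      q powi (m - r + s + 1 - (k - r)) * gauss (m - r + s) (k - r - 1)"
    using gauss_Pascal[of "m - r + s + 1" "k - r"] assms by simp
  moreover have "q powi (n + (k - s - 1) * (k - r)) * q powi (m - r + s + 1 - (k - r)) =
      q powi (m + n) * q powi ((k - 1 - s) * (k - 1 - r))"
    unfolding q_powi_add[symmetric] by (rule arg_cong[of _ _ "(powi) q"]) (simp add: algebra_simps)
  moreover have "m + 1 - r + s = m - r + s + 1" "k - 1 - s = k - s - 1" "k - 1 - r = k - r - 1"
    by simp_all
  ultimately show ?thesis
    unfolding gp_small_def gp_large_def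
    by (simp only: distrib_left distrib_right mult.assoc[symmetric])
qed

lemma gp_large_asc: "gp_large m r (n + 1) s k = gp m r n s k"
  by (simp add: gp_large_def gp_def algebra_simps)

text \<open>Same right side as \<open>gp_small_asc\<close>, since the deleted letter again lies
  between the last letters that remain. The factor \<open>q powi n\<close> on the left is the new
  descent of \<open>ys\<close>.\<close>

lemma gp_large_desc:
  assumes "0 \<le> m - r + s"
  shows "q powi n * gp_large m r (n + 1) (s + 1) k =
    gp_small m r n s k + q powi (m + n) * gp_large m r n s (k - 1)"
proof -
  have "gauss (m - r + s + 1) (k - r) = gauss (m - r + s) (k - r) +
      q powi (m - r + s + 1 - (k - r)) * gauss (m - r + s) (k - r - 1)"
    using gauss_Pascal[of "m - r + s + 1" "k - r"] assms by simp
  moreover have "q powi (n + (k - s - 1) * (k - r)) = q powi n * q powi ((k - s - 1) * (k - r))"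
    by (rule q_powi_add)
  moreover have "q powi ((k - s - 1) * (k - r)) * q powi (m - r + s + 1 - (k - r)) =
      q powi m * q powi ((k - s - 1) * (k - r - 1))"
    unfolding q_powi_add[symmetric] by (rule arg_cong[of _ _ "(powi) q"]) (simp add: algebra_simps)
  moreover have "m - r + (s + 1) = m - r + s + 1" "k - 1 - s = k - s - 1" "k - 1 - r = k - r - 1"
      "n + 1 - (s + 1) + r - 1 = n - s + r - 1" "k - (s + 1) = k - s - 1"
      "q powi (m + n) = q powi m * q powi n"
    by (simp_all add: q_powi_add)
  ultimately show ?thesis
    unfolding gp_small_def gp_large_def
    by (simp only: distrib_left distrib_right mult.assoc[symmetric]) (simp add: mult_ac)
qed

section \<open>Induction on the total length\<close>

text \<open>
  The formulas for \<open>gp_small\<close> and \<open>gp_large\<close> assume \<open>last xs < last ys\<close>; an empty word counts as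
  having a smaller last letter than any nonempty one.
\<close>

definition last_less :: "nat list \<Rightarrow> nat list \<Rightarrow> bool" where
  "last_less xs ys \<longleftrightarrow> ys \<noteq> [] \<and> (xs = [] \<or> last xs < last ys)"

abbreviation gp_of :: "(int \<Rightarrow> int \<Rightarrow> int \<Rightarrow> int \<Rightarrow> int \<Rightarrow> int poly fract) \<Rightarrow>
    nat list \<Rightarrow> nat list \<Rightarrow> int \<Rightarrow> int poly fract" where
  "gp_of f xs ys k \<equiv> q powi (int (maj xs) + int (maj ys)) *
     f (int (length xs)) (int (des xs)) (int (length ys)) (int (des ys)) k"

text \<open>The total and the refined formulas are proved together: deleting the final letter may
  lose the order of the last letters, and then only the total formula can be applied.\<close>

lemma gf_shuffles_aux:
  assumes "set xs \<inter> set ys = {}"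
  shows "(\<forall>k. gf (shuffles xs ys) k = gp_of gp xs ys k) \<and>
    (last_less xs ys \<longrightarrow> (\<forall>k. gf (shuffles_last xs ys) k = gp_of gp_small xs ys k \<and>
       gf (shuffles_last ys xs) k = gp_of gp_large xs ys k))"
  using assms
proof (induction "length xs + length ys" arbitrary: xs ys rule: less_induct)
  case less
  \<comment> \<open>Stated for arbitrary words of bounded total length, so that it also serves for
    \<open>xs\<close> and \<open>ys\<close> exchanged.\<close>
  have small_large: "gf (shuffles_last us vs) k = gp_of gp_small us vs k \<and>
       gf (shuffles_last vs us) k = gp_of gp_large us vs k"
    if below: "last_less us vs" and len: "length us + length vs \<le> length xs + length ys"
      and disj: "set us \<inter> set vs = {}" for us vs k
  proof
    have IH: "gf (shuffles us' vs') k = gp_of gp us' vs' k"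
        "last_less us' vs' \<Longrightarrow> gf (shuffles_last us' vs') k = gp_of gp_small us' vs' k"
        "last_less us' vs' \<Longrightarrow> gf (shuffles_last vs' us') k = gp_of gp_large us' vs' k"
      if "length us' + length vs' < length us + length vs" "set us' \<inter> set vs' = {}" for us' vs' k
      using less.hyps[of us' vs'] that len by auto
    show "gf (shuffles_last us vs) k = gp_of gp_small us vs k"
    proof (cases us rule: rev_cases)
      case Nil
      \<comment> \<open>The first Gaussian factor needs \<open>k <= s\<close>, the second
        \<open>k >= s + 1\<close>.\<close>
      have "gp_small 0 0 (int (length vs)) (int (des vs)) k = 0"
        by (auto simp: gp_small_def gauss_def)
      then show ?thesis
        using Nil by simp
    next
      case (snoc us' x)
      have vs: "vs \<noteq> []" "x < last vs" "set us' \<inter> set vs = {}" "set vs \<inter> set us' = {}"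
        using below disj snoc by (auto simp: last_less_def)
      let ?m = "int (length us')" and ?r = "int (des us')" and ?n = "int (length vs)"
        and ?s = "int (des vs)" and ?M = "int (maj us') + int (maj vs)"
      have rec: "gf (shuffles_last us vs) k =
          (if us' \<noteq> [] \<and> x < last us' then q powi (?m + ?n) * gf (shuffles_last us' vs) (k - 1)
           else gf (shuffles_last us' vs) k) + q powi (?m + ?n) * gf (shuffles_last vs us') (k - 1)"
        using gf_shuffles_last_snoc[of us' x vs k] disj vs snoc by simp
      show ?thesis
      proof (cases "us' \<noteq> [] \<and> x < last us'")
        case True
        \<comment> \<open>\<open>x\<close> is below both \<open>last us'\<close> and
          \<open>last vs\<close>, so both parts gain a descent and recombine; the order of these two
          letters is unknown.\<close>
        then have "gf (shuffles_last us vs) k = q powi (?m + ?n) * gf (shuffles us' vs) (k - 1)"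
          using rec gf_shuffles_split[of us' vs] vs by (simp add: distrib_left)
        also have "\<dots> = q powi (?m + ?n) * (q powi ?M * gp ?m ?r ?n ?s (k - 1))"
          using IH(1)[of us' vs] vs snoc by simp
        also have "\<dots> = q powi (?M + ?m) * gp_small (?m + 1) (?r + 1) ?n ?s k"
          by (simp add: gp_small_desc q_powi_add mult_ac)
        finally show ?thesis
          using True snoc by (simp add: maj_snoc des_snoc add_ac)
      next
        case False
        \<comment> \<open>Either \<open>us'\<close> is empty or
          \<open>last us' <= x < last vs\<close>, so the refined hypotheses apply.\<close>
        have "last_less us' vs"
          using False vs by (auto simp: last_less_def)
        then have "gf (shuffles_last us vs) k = q powi ?M * gp_small ?m ?r ?n ?s k +
            q powi (?m + ?n) * (q powi ?M * gp_large ?m ?r ?n ?s (k - 1))"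
          using rec False IH(2,3)[of us' vs] vs snoc by simp
        also have "\<dots> = q powi ?M * gp_small (?m + 1) ?r ?n ?s k"
          using des_le_length[of us'] by (subst gp_small_asc) (simp_all add: algebra_simps)
        finally show ?thesis
          using False snoc by (cases "us' = []") (simp_all add: maj_snoc des_snoc add_ac)
      qed
    qed
    obtain vs' y where snoc: "vs = vs' @ [y]"
      using below by (cases vs rule: rev_cases) (auto simp: last_less_def)
    have us: "us = [] \<or> last us < y" "set us \<inter> set vs' = {}" "set vs' \<inter> set us = {}"
      using below disj snoc by (auto simp: last_less_def)
    let ?m = "int (length us)" and ?r = "int (des us)" and ?n = "int (length vs')"
      and ?s = "int (des vs')" and ?M = "int (maj us) + int (maj vs')"
    show "gf (shuffles_last vs us) k = gp_of gp_large us vs k"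
    proof (cases "us = [] \<and> vs' = []")
      case True
      \<comment> \<open>Deleting \<open>y\<close> leaves the empty word, so the recursion does not
        cover this case.\<close>
      then have "shuffles_last vs us = {[y]}"
        using snoc by (auto simp: shuffles_last_def)
      then show ?thesis
        using True snoc gp_zero gp_large_asc[of 0 0 0 0 k] by (simp add: gf_singleton)
    next
      case nonempty: False
      have rec: "gf (shuffles_last vs us) k =
          (if vs' \<noteq> [] \<and> y < last vs' then q powi (?m + ?n) * gf (shuffles_last vs' us) (k - 1)
           else gf (shuffles_last vs' us) k) + gf (shuffles_last us vs') k"
        using gf_shuffles_last_snoc[of vs' y us k] disj us snoc nonempty by (auto simp: add_ac)
      show ?thesis
      proof (cases "vs' \<noteq> [] \<and> y < last vs'")
        case True
        have "last_less us vs'"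
          using True us by (auto simp: last_less_def)
        then have "gf (shuffles_last vs us) k = q powi ?M * gp_small ?m ?r ?n ?s k +
            q powi (?m + ?n) * (q powi ?M * gp_large ?m ?r ?n ?s (k - 1))"
          using rec True IH(2,3)[of us vs'] us snoc by simp
        also have "\<dots> = q powi ?M * (q powi ?n * gp_large ?m ?r (?n + 1) (?s + 1) k)"
          using des_le_length[of us] by (subst gp_large_desc) (simp_all add: algebra_simps)
        also have "\<dots> = q powi (?M + ?n) * gp_large ?m ?r (?n + 1) (?s + 1) k"
          by (simp add: q_powi_add mult_ac)
        finally show ?thesis
          using True snoc by (simp add: maj_snoc des_snoc add_ac)
      next
        case False
        \<comment> \<open>\<open>y\<close> closes no descent after either word, so both parts
          recombine to all shuffles.\<close>
        then have "gf (shuffles_last vs us) k = gf (shuffles us vs') k"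
          using rec gf_shuffles_split[of us vs'] us nonempty by (auto simp: add_ac)
        also have "\<dots> = q powi ?M * gp ?m ?r ?n ?s k"
          using IH(1)[of us vs'] us snoc by simp
        also have "\<dots> = q powi ?M * gp_large ?m ?r (?n + 1) ?s k"
          by (simp only: gp_large_asc)
        finally show ?thesis
          using False snoc by (cases "vs' = []") (simp_all add: maj_snoc des_snoc add_ac)
      qed
    qed
  qed
  have total: "gf (shuffles us vs) k = gp_of gp us vs k"
    if "last_less us vs" "length us + length vs \<le> length xs + length ys" "set us \<inter> set vs = {}"
    for us vs k
  proof -
    have "vs \<noteq> []"
      using that by (simp add: last_less_def)
    \<comment> \<open>The bound that \<open>gp_split\<close> asks for; it fails for two empty words,
      which are treated separately below.\<close>
    then have "1 \<le> int (length vs) - int (des vs) + int (des us)"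
      using des_less_length[of vs] by linarith
    then show ?thesis
      using small_large[OF that] gf_shuffles_split[of us vs] that \<open>vs \<noteq> []\<close>
      by (simp flip: gp_split add: distrib_left)
  qed
  have "last xs \<noteq> last ys" if "xs \<noteq> []" "ys \<noteq> []"
    using less.prems last_in_set[OF that(1)] last_in_set[OF that(2)] by auto
  then consider "xs = []" "ys = []" | "last_less xs ys" | "last_less ys xs"
    unfolding last_less_def by (metis linorder_cases)
  then have "gf (shuffles xs ys) k = gp_of gp xs ys k" for k
  proof cases
    case 1
    then show ?thesis
      by (simp add: gf_singleton gp_zero)
  next
    case 2
    then show ?thesis
      using total less.prems by simp
  next
    case 3
    then show ?thesis
      using total[of ys xs k] less.prems gp_commute
      by (simp add: shuffles_commutes[of ys xs] Int_commute add_ac)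
  qed
  then show ?case
    using small_large less.prems by blast
qed

text \<open>Stanley's shuffling theorem.\<close>

lemma gf_shuffles:
  assumes "set xs \<inter> set ys = {}"
  shows "gf (shuffles xs ys) k = gp_of gp xs ys k"
  using gf_shuffles_aux[OF assms] by blast

section \<open>Rotation classes\<close>

lemma in_rotation_class_iff: "x \<in> rotation_class w \<longleftrightarrow> (\<exists>u v. w = u @ v \<and> x = v @ u)"
proof
  assume "x \<in> rotation_class w"
  then obtain i where "x = rotate i w"
    by (auto simp: rotation_class_def)
  then have "x = drop (i mod length w) w @ take (i mod length w) w"
    by (simp add: rotate_drop_take)
  then show "\<exists>u v. w = u @ v \<and> x = v @ u"
    by (metis append_take_drop_id)
next
  assume "\<exists>u v. w = u @ v \<and> x = v @ u"
  then obtain u v where "w = u @ v" "x = v @ u"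
    by blast
  then have "x = rotate (length u) w"
    by (simp add: rotate_append)
  then show "x \<in> rotation_class w"
    by (auto simp: rotation_class_def)
qed

lemma self_in_rotation_class [simp]: "w \<in> rotation_class w"
  unfolding in_rotation_class_iff by (intro exI[of _ "[]"] exI[of _ w]) simp

lemma rotation_class_eqI:
  assumes "x \<in> rotation_class w"
  shows "rotation_class x = rotation_class w"
proof -
  have sub: "rotation_class v \<subseteq> rotation_class u" if "v \<in> rotation_class u" for u v
    using that by (auto simp: rotation_class_def rotate_rotate)
  have "w \<in> rotation_class x"
    using assms unfolding in_rotation_class_iff by blast
  then show ?thesis
    using sub assms by blast
qed

lemma set_in_rotation_class: "x \<in> rotation_class w \<Longrightarrow> set x = set w"
  by (auto simp: rotation_class_def)

lemma length_in_rotation_class: "x \<in> rotation_class w \<Longrightarrow> length x = length w"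
  by (auto simp: rotation_class_def)

lemma distinct_in_rotation_class: "x \<in> rotation_class w \<Longrightarrow> distinct x = distinct w"
  by (auto simp: rotation_class_def)

lemma letters_rotation_class [simp]: "letters (rotation_class w) = set w"
  by (auto simp: letters_def rotation_class_def)

lemma filter_eq_appendE:
  assumes "filter P w = u' @ v'"
  obtains u v where "w = u @ v" "u' = filter P u" "v' = filter P v"
proof -
  have "\<exists>u v. w = u @ v \<and> u' = filter P u \<and> v' = filter P v"
    using assms
  proof (induction w arbitrary: u')
    case (Cons a w)
    show ?case
    proof (cases "u' = []")
      case True
      then show ?thesis
        using Cons.prems by (intro exI[of _ "[]"] exI[of _ "a # w"]) simp
    next
      case False
      then obtain u'' where "filter P w = u'' @ v'" "u' = (if P a then a # u'' else u'')"
        using Cons.prems by (cases u') (auto split: if_splits)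
      then obtain u v where "w = u @ v" "u'' = filter P u" "v' = filter P v"
        using Cons.IH by blast
      then show ?thesis
        using \<open>u' = _\<close> by (intro exI[of _ "a # u"] exI[of _ v]) simp
    qed
  qed simp
  then show ?thesis
    using that by blast
qed

text \<open>Every cut of the filtered word lifts to a cut of the word. Deleting letters from a class
  can thus be computed on any one member.\<close>

lemma filter_rotation_class: "filter P ` rotation_class w = rotation_class (filter P w)"
proof (intro equalityI subsetI)
  fix x assume "x \<in> filter P ` rotation_class w"
  then obtain u v where "w = u @ v" "x = filter P (v @ u)"
    by (auto simp: in_rotation_class_iff)
  then show "x \<in> rotation_class (filter P w)"
    unfolding in_rotation_class_iff by (intro exI[of _ "filter P u"] exI[of _ "filter P v"]) simp
next
  fix x assume "x \<in> rotation_class (filter P w)"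
  then obtain u' v' where filter_w: "filter P w = u' @ v'" and "x = v' @ u'"
    by (auto simp: in_rotation_class_iff)
  from filter_w obtain u v where "w = u @ v" "u' = filter P u" "v' = filter P v"
    by (rule filter_eq_appendE)
  then have "v @ u \<in> rotation_class w" "x = filter P (v @ u)"
    using \<open>x = v' @ u'\<close> by (auto simp: in_rotation_class_iff)
  then show "x \<in> filter P ` rotation_class w"
    by blast
qed

text \<open>If \<open>u @ v\<close> and \<open>v @ u\<close> with both parts nonempty began alike,
  the common letter would occur in \<open>u\<close> and in \<open>v\<close>.\<close>

lemma rotation_class_hd_unique:
  assumes "distinct w" "x \<in> rotation_class w" "y \<in> rotation_class w" "hd x = hd y"
  shows "x = y"
proof -
  have "y \<in> rotation_class x"
    using assms rotation_class_eqI by blast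
  then obtain u v where uv: "x = u @ v" "y = v @ u"
    unfolding in_rotation_class_iff by blast
  have "distinct x"
    using assms distinct_in_rotation_class by blast
  then show ?thesis
    using uv assms(4) by (cases u; cases v) auto
qed

lemma start_at_hd:
  assumes "distinct w" "x \<in> rotation_class w" "x \<noteq> []"
  shows "start_at (hd x) (rotation_class w) = x"
  unfolding start_at_def
  by (rule the_equality) (use assms rotation_class_hd_unique[of w] in auto)

lemma start_at_rotation_class:
  assumes "distinct w" "i \<in> set w"
  shows "start_at i (rotation_class w) \<in> rotation_class w"
    and "start_at i (rotation_class w) \<noteq> []"
    and "hd (start_at i (rotation_class w)) = i"
proof -
  obtain u v where "w = u @ i # v"
    using assms split_list by metis
  then have "(i # v) @ u \<in> rotation_class w"
    unfolding in_rotation_class_iff by blast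
  then have "start_at i (rotation_class w) = i # v @ u \<and> i # v @ u \<in> rotation_class w"
    using start_at_hd[OF assms(1), of "(i # v) @ u"] by simp
  then show "start_at i (rotation_class w) \<in> rotation_class w"
      "start_at i (rotation_class w) \<noteq> []" "hd (start_at i (rotation_class w)) = i"
    by auto
qed

lemma cyc_rep_Cons:
  assumes "distinct (M # b)" "\<forall>x\<in>set b. x \<le> M"
  shows "cyc_rep (rotation_class (M # b)) = M # b"
proof -
  have "Max (set (M # b)) = M"
    using assms by (intro Max_eqI) auto
  then show ?thesis
    unfolding cyc_rep_def letters_rotation_class
    using start_at_hd[OF assms(1) self_in_rotation_class] by simp
qed

section \<open>Cyclic shuffles\<close>

text \<open>Cut a cyclic shuffle at \<open>M\<close>. Deleting the letters of \<open>p\<close>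
  leaves the one member of its class that starts with \<open>M\<close>, while deleting the others
  leaves some rotation of \<open>p\<close>, fixed by its first letter \<open>i\<close>.\<close>

lemma cyclic_shuffles_Cons:
  assumes t: "distinct (M # t)" and p: "distinct p" "p \<noteq> []"
    and disj: "set (M # t) \<inter> set p = {}" and pos: "\<forall>x\<in>set (M # t) \<union> set p. 0 < x"
  shows "cyclic_shuffles (rotation_class (M # t)) (rotation_class p) =
    (\<lambda>b. rotation_class (M # b)) ` (\<Union>i\<in>set p. shuffles t (start_at i (rotation_class p)))"
proof (intro equalityI subsetI)
  let ?S = "rotation_class (M # t)" and ?P = "rotation_class p"
  fix A assume A: "A \<in> cyclic_shuffles ?S ?P"
  then obtain w where w: "distinct w" "A = rotation_class w"
    by (auto simp: cyclic_shuffles_def cyclic_perm_def linear_perm_def)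
  have set_w: "set w = set (M # t) \<union> set p"
    using A w by (auto simp: cyclic_shuffles_def)
  let ?x = "start_at M A"
  have x: "?x \<in> rotation_class w" "?x \<noteq> []" "hd ?x = M"
    using start_at_rotation_class[OF w(1), of M] set_w w by auto
  then obtain b where b: "?x = M # b"
    by (cases ?x) auto
  have A_eq: "A = rotation_class (M # b)"
    using rotation_class_eqI x b w by simp
  have "distinct (M # b)" "set (M # b) = set (M # t) \<union> set p"
    using x b w set_w distinct_in_rotation_class set_in_rotation_class by metis+
  then have set_b: "M \<notin> set b" "set b = set t \<union> set p"
    using t disj by auto
  have "rotation_class (filter (\<lambda>x. x \<notin> set p) (M # b)) = ?S"
    using A unfolding cyclic_shuffles_def A_eq delete_letters_def
    by (simp only: filter_rotation_class letters_rotation_class mem_Collect_eq)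
  then have "M # filter (\<lambda>x. x \<notin> set p) b \<in> ?S"
    using disj by (metis (no_types, lifting) Int_iff emptyE filter.simps(2) list.set_intros(1)
        self_in_rotation_class)
  then have "M # filter (\<lambda>x. x \<notin> set p) b = M # t"
    by (intro rotation_class_hd_unique[OF t]) simp_all
  then have filter_t: "filter (\<lambda>x. x \<notin> set p) b = t"
    by simp
  \<comment> \<open>The double negation is the complementary half in
    \<open>partition_in_shuffles\<close>.\<close>
  have "filter (\<lambda>x. x \<notin> set (M # t)) (M # b) = filter (\<lambda>x. \<not> x \<notin> set p) b"
    using set_b disj by (auto intro!: filter_cong)
  moreover have "rotation_class (filter (\<lambda>x. x \<notin> set (M # t)) (M # b)) = ?P"
    using A unfolding cyclic_shuffles_def A_eq delete_letters_def
    by (simp only: filter_rotation_class letters_rotation_class mem_Collect_eq)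
  ultimately have p': "filter (\<lambda>x. \<not> x \<notin> set p) b \<in> ?P"
    by (metis self_in_rotation_class)
  define p' where "p' = filter (\<lambda>x. \<not> x \<notin> set p) b"
  have "p' \<noteq> []"
    using length_in_rotation_class[OF p'] p by (auto simp: p'_def)
  then have "start_at (hd p') ?P = p'" "hd p' \<in> set p"
    using start_at_hd[OF p(1), of p'] p' set_in_rotation_class[OF p'] hd_in_set[of p']
    by (simp_all add: p'_def)
  moreover have "b \<in> shuffles t p'"
    using partition_in_shuffles[of b "\<lambda>x. x \<notin> set p"] filter_t by (simp add: p'_def)
  ultimately show "A \<in> (\<lambda>b. rotation_class (M # b)) ` (\<Union>i\<in>set p. shuffles t (start_at i ?P))"
    using A_eq by force
next
  let ?S = "rotation_class (M # t)" and ?P = "rotation_class p"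
  fix A assume "A \<in> (\<lambda>b. rotation_class (M # b)) ` (\<Union>i\<in>set p. shuffles t (start_at i ?P))"
  then obtain b i where b: "A = rotation_class (M # b)" "i \<in> set p" "b \<in> shuffles t (start_at i ?P)"
    by auto
  define p' where "p' = start_at i ?P"
  have p': "p' \<in> ?P"
    using start_at_rotation_class(1)[OF p(1) b(2)] by (simp add: p'_def)
  then have p'_facts: "set p' = set p" "distinct p'" "length p' = length p"
    using set_in_rotation_class distinct_in_rotation_class length_in_rotation_class p by blast+
  have b': "b \<in> shuffles t p'"
    using b by (simp add: p'_def)
  have disj': "set t \<inter> set p' = {}"
    using disj p'_facts by auto
  have set_b: "set b = set t \<union> set p" "distinct b" "length b = length t + length p"
    using set_shuffles[OF b'] distinct_disjoint_shuffles[OF _ _ disj' b'] length_shuffles[OF b']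
      t p'_facts by auto
  have "linear_perm (card (set (M # t)) + card (set p)) (M # b)"
    using set_b t p disj pos distinct_card[OF t] distinct_card[OF p(1)]
    by (auto simp: linear_perm_def)
  then have "cyclic_perm (card (set (M # t)) + card (set p)) A"
    using b(1) by (auto simp: cyclic_perm_def)
  moreover have "letters A = set (M # t) \<union> set p"
    using b(1) set_b by auto
  moreover have "filter (\<lambda>x. x \<notin> set p) b = t"
  proof -
    have "filter (\<lambda>x. x \<notin> set p) b = filter (\<lambda>x. x \<in> set t) b"
      using disj set_b by (intro filter_cong) auto
    then show ?thesis
      using filter_shuffles_disjoint1(1)[OF disj' b'] by simp
  qed
  moreover have "filter (\<lambda>x. x \<notin> set (M # t)) b = p'"
  proof -
    have "filter (\<lambda>x. x \<notin> set (M # t)) b = filter (\<lambda>x. x \<in> set p') b"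
      using disj set_b p'_facts by (intro filter_cong) auto
    then show ?thesis
      using filter_shuffles_disjoint2(1)[OF disj' b'] by simp
  qed
  then have "filter (\<lambda>x. x \<notin> set (M # t)) (M # b) = p'"
    by simp
  ultimately show "A \<in> cyclic_shuffles ?S ?P"
    unfolding cyclic_shuffles_def mem_Collect_eq delete_letters_def b(1) filter_rotation_class
      letters_rotation_class
    using disj rotation_class_eqI[OF p'] by simp
qed

text \<open>As \<open>des b + 1 = k\<close>, the major index \<open>maj b + des b + 1\<close> is
  \<open>maj b + k\<close>, which gives the factor \<open>q ^ k\<close>. For \<open>k = 0\<close>
  both sides are 0.\<close>

lemma sum_cyclic_shuffles_Cons:
  assumes t: "distinct (M # t)" and p: "distinct p" "p \<noteq> []"
    and disj: "set (M # t) \<inter> set p = {}" and pos: "\<forall>x\<in>set (M # t) \<union> set p. 0 < x"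
    and less: "\<forall>x\<in>set t \<union> set p. x < M"
  shows "(\<Sum>\<alpha>\<in>{\<alpha> \<in> cyclic_shuffles (rotation_class (M # t)) (rotation_class p). cyc_cdes \<alpha> = k}.
      q ^ cyc_maj \<alpha>) =
    (\<Sum>i\<in>set p. q ^ k * gf (shuffles t (start_at i (rotation_class p))) (int k - 1))"
proof -
  let ?P = "rotation_class p"
  define B where "B i = {b \<in> shuffles t (start_at i ?P). int (des b) = int k - 1}" for i
  let ?f = "\<lambda>b. rotation_class (M # b)"
  have S: "set (start_at i ?P) = set p" "distinct (start_at i ?P)" "start_at i ?P \<noteq> []"
      "hd (start_at i ?P) = i" if "i \<in> set p" for i
    using start_at_rotation_class[OF p(1) that] set_in_rotation_class distinct_in_rotation_class p
    by blast+
  have b: "b \<noteq> []" "distinct (M # b)" "\<forall>x\<in>set b. x < M"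
      "filter (\<lambda>x. x \<in> set p) b = start_at i ?P"
    if i: "i \<in> set p" and "b \<in> shuffles t (start_at i ?P)" for b i
  proof -
    note b = that(2)
    have disj': "set t \<inter> set (start_at i ?P) = {}"
      using disj S[OF i] by auto
    show "filter (\<lambda>x. x \<in> set p) b = start_at i ?P"
      using filter_shuffles_disjoint2(1)[OF disj' b] S[OF i] by simp
    have set_b: "set b = set t \<union> set p" "distinct b"
      using set_shuffles[OF b] distinct_disjoint_shuffles[OF _ _ disj' b] t S[OF i] by auto
    then show "distinct (M # b)" "\<forall>x\<in>set b. x < M"
      using t disj less by auto
    show "b \<noteq> []"
      using set_b p by auto
  qed
  have stat: "cyc_cdes (?f b) = Suc (des b)" "cyc_maj (?f b) = maj b + des b + 1"
    if "i \<in> set p" "b \<in> shuffles t (start_at i ?P)" for b i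
  proof -
    note b' = b[OF that]
    \<comment> \<open>The step from \<open>M\<close> to \<open>hd b\<close> is a descent; the return
      from \<open>last b\<close> to \<open>M\<close> is not.\<close>
    have hd_last: "hd b < M" "\<not> M < last b"
      using b'(1,3) by (simp_all add: less_imp_le not_less)
    then show "cyc_cdes (?f b) = Suc (des b)"
      using b'(1) by (simp add: cyc_cdes_rotation_class cdes_eq des_Cons)
    show "cyc_maj (?f b) = maj b + des b + 1"
      using b'(1-3) cyc_rep_Cons[of M b] hd_last(1)
      by (simp add: cyc_maj_def maj_Cons less_imp_le)
  qed
  have inj: "inj_on ?f (\<Union>i\<in>set p. B i)"
  proof (rule inj_onI)
    fix x y assume xy: "x \<in> (\<Union>i\<in>set p. B i)" "y \<in> (\<Union>i\<in>set p. B i)" "?f x = ?f y"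
    then have "distinct (M # x)"
      using b(2) by (auto simp: B_def)
    moreover have "M # y \<in> rotation_class (M # x)"
      using xy(3) by simp
    ultimately have "M # x = M # y"
      by (intro rotation_class_hd_unique[of "M # x"]) auto
    then show "x = y"
      by simp
  qed
  \<comment> \<open>\<open>i\<close> can be read off from \<open>b\<close> as its first letter that
    belongs to \<open>p\<close>.\<close>
  have B_disj: "B i \<inter> B j = {}" if "i \<in> set p" "j \<in> set p" "i \<noteq> j" for i j
  proof -
    have hd_filter: "hd (filter (\<lambda>x. x \<in> set p) x) = l" if "l \<in> set p" "x \<in> B l" for l x
      using b(4)[of l x] S(4)[of l] that by (simp add: B_def)
    have "i = j" if "x \<in> B i" "x \<in> B j" for x
      using hd_filter[of i x] hd_filter[of j x] that \<open>i \<in> set p\<close> \<open>j \<in> set p\<close> by simp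
    then show ?thesis
      using that by blast
  qed
  have "{\<alpha> \<in> cyclic_shuffles (rotation_class (M # t)) ?P. cyc_cdes \<alpha> = k} = ?f ` (\<Union>i\<in>set p. B i)"
    unfolding cyclic_shuffles_Cons[OF t p disj pos] using stat(1) by (fastforce simp: B_def)
  then have "(\<Sum>\<alpha>\<in>{\<alpha> \<in> cyclic_shuffles (rotation_class (M # t)) ?P. cyc_cdes \<alpha> = k}. q ^ cyc_maj \<alpha>) =
      (\<Sum>b\<in>(\<Union>i\<in>set p. B i). q ^ cyc_maj (?f b))"
    by (simp add: sum.reindex[OF inj])
  also have "\<dots> = (\<Sum>i\<in>set p. \<Sum>b\<in>B i. q ^ cyc_maj (?f b))"
    using B_disj by (intro sum.UNION_disjoint) (auto simp: B_def)
  also have "\<dots> = (\<Sum>i\<in>set p. \<Sum>b\<in>B i. q ^ k * q ^ maj b)"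
  proof (intro sum.cong refl)
    fix i b assume ib: "i \<in> set p" "b \<in> B i"
    then have "cyc_maj (?f b) = k + maj b"
      using stat(2)[of i b] by (auto simp: B_def)
    then show "q ^ cyc_maj (?f b) = q ^ k * q ^ maj b"
      by (simp add: power_add)
  qed
  finally show ?thesis
    by (simp add: gf_def B_def sum_distrib_left)
qed

section \<open>From one rotation to the two sums of the theorem\<close>

text \<open>
  With \<open>p\<close> the rotation of \<open>\<pi>\<close> starting at \<open>i\<close>, \<open>des p\<close> is \<open>cdes \<pi> - 1\<close> if \<open>i\<close> is a cyclic descent
  bottom and \<open>cdes \<pi>\<close> otherwise; this one formula thus yields both summands of the theorem.
\<close>

lemma gf_shuffles_Cons:
  fixes k :: int
  assumes disj: "set t \<inter> set p = {}" and p: "p \<noteq> []" and less: "\<forall>x\<in>set t. x < M"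
  defines "m \<equiv> int (length (M # t))" and "n \<equiv> int (length p)"
    and "r \<equiv> int (des (M # t))" and "s \<equiv> int (des p)"
  shows "q powi k * gf (shuffles t p) (k - 1) =
    gauss (m - r + s) (k - r) * gauss (n - s + r - 1) (k - s - 1) *
    q powi (int (maj (M # t)) + (k - s) * (k - r)) * q ^ maj p"
proof (cases "t = []")
  case True
  \<comment> \<open>Here \<open>r = 0\<close> and not \<open>des t + 1\<close>, so the Gaussian
    factors on the two sides differ; they agree because each side vanishes unless
    \<open>k = s + 1\<close>.\<close>
  have "s < n"
    using des_less_length[OF p] by (simp add: s_def n_def)
  have "q powi k * gp 0 0 n s (k - 1) =
      gauss (1 + s) k * gauss (n - s - 1) (k - s - 1) * q powi ((k - s) * k)"
  proof (cases "k = s + 1")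
    case True
    then show ?thesis
      using \<open>s < n\<close> gauss_self[of "s + 1"] by (simp add: gp_def s_def add.commute)
  next
    case False
    then have "k - 1 < s \<or> s < k - 1"
      by linarith
    then show ?thesis
      by (auto simp: gp_def gauss_eq_0)
  qed
  then show ?thesis
    using True gf_shuffles[OF disj, of "k - 1"]
    by (simp add: m_def n_def r_def s_def mult_ac)
next
  case False
  have M: "hd t < M"
    using False less by simp
  define m' r' where "m' = int (length t)" and "r' = int (des t)"
  have mr: "m = m' + 1" "r = r' + 1" "int (maj (M # t)) = int (maj t) + r"
    using False M by (simp_all add: m_def r_def m'_def r'_def des_Cons maj_Cons)
  let ?e = "q powi (int (maj t) + int (maj p))" and ?e' = "q powi ((k - 1 - s) * (k - 1 - r'))"
  \<comment> \<open>As \<open>k - 1 - r' = k - r\<close>, lowering \<open>k - s\<close> by one costs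
    \<open>k - r\<close>; the remaining \<open>r\<close> out of \<open>k\<close> is the gap between
    \<open>maj t\<close> and \<open>maj (M # t)\<close>.\<close>
  have "k + (int (maj t) + int (maj p) + (k - 1 - s) * (k - 1 - r')) =
      int (maj (M # t)) + (k - s) * (k - r) + int (maj p)"
    unfolding mr by (simp add: algebra_simps)
  then have expo: "q powi k * (?e * ?e') =
      q powi (int (maj (M # t)) + (k - s) * (k - r)) * q ^ maj p"
    by (simp only: q_powi_add[symmetric] power_int_of_nat[symmetric])
  have args: "m' - r' + s = m - r + s" "n - s + r' = n - s + r - 1" "k - 1 - r' = k - r"
      "k - 1 - s = k - s - 1"
    unfolding mr by simp_all
  have "gf (shuffles t p) (k - 1) =
      ?e * (?e' * gauss (m' - r' + s) (k - 1 - r') * gauss (n - s + r') (k - 1 - s))"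
    using gf_shuffles[OF disj, of "k - 1"] unfolding gp_def m'_def r'_def n_def s_def .
  then have "q powi k * gf (shuffles t p) (k - 1) =
      gauss (m' - r' + s) (k - 1 - r') * gauss (n - s + r') (k - 1 - s) * (q powi k * (?e * ?e'))"
    by (simp only: mult_ac)
  then show ?thesis
    unfolding expo by (simp only: args mult.assoc)
qed

theorem theorem1p3:
  fixes m n r s k :: nat and \<sigma> \<pi> :: "nat list set"
  assumes "m \<ge> 1" and "n \<ge> 1"
    and "cyclic_perm m \<sigma>" and "cyclic_perm n \<pi>"
    and "letters \<sigma> \<inter> letters \<pi> = {}"
    and "cyc_cdes \<sigma> = r" and "cyc_cdes \<pi> = s"
    and "Max (letters \<sigma> \<union> letters \<pi>) \<in> letters \<sigma>"
  shows "(\<Sum>\<alpha>\<in>{\<alpha>\<in>cyclic_shuffles \<sigma> \<pi>. cyc_cdes \<alpha> = k}. q ^ cyc_maj \<alpha>) =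
      gauss (int m - int r + int s) (int k - int r)
        * gauss (int n - int s + int r - 1) (int k - int s - 1)
        * q powi (int (cyc_maj \<sigma>) + (int k - int s) * (int k - int r))
        * (\<Sum>i\<in>letters \<pi> - cyc_cBd \<pi>. q ^ maj (start_at i \<pi>))
    + gauss (int m - int r + int s - 1) (int k - int r)
        * gauss (int n - int s + int r) (int k - int s)
        * q powi (int (cyc_maj \<sigma>) + (int k - int s + 1) * (int k - int r))
        * (\<Sum>i\<in>letters \<pi> \<inter> cyc_cBd \<pi>. q ^ maj (start_at i \<pi>))"
proof -
  obtain w where w: "linear_perm m w" "\<sigma> = rotation_class w"
    using assms(3) by (auto simp: cyclic_perm_def)
  obtain p where p: "linear_perm n p" "\<pi> = rotation_class p"
    using assms(4) by (auto simp: cyclic_perm_def)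
  have dist: "distinct w" "distinct p" and len: "length w = m" "length p = n"
    using w p by (auto simp: linear_perm_def)
  define M where "M = Max (letters \<sigma> \<union> letters \<pi>)"
  have M: "M \<in> set w" and M_max: "\<forall>x\<in>set w \<union> set p. x \<le> M"
    using assms(8) w p by (auto simp: M_def)
  obtain t where t: "start_at M \<sigma> = M # t"
    using start_at_rotation_class[OF dist(1) M] w by (metis list.exhaust_sel)
  then have Mt: "M # t \<in> rotation_class w"
    using start_at_rotation_class(1)[OF dist(1) M] w by simp
  have \<sigma>: "\<sigma> = rotation_class (M # t)"
    using rotation_class_eqI[OF Mt] w by simp
  have set_t: "set (M # t) = set w" "distinct (M # t)" "length (M # t) = m"
    using Mt dist len set_in_rotation_class distinct_in_rotation_class length_in_rotation_class
    by metis+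
  have disj: "set (M # t) \<inter> set p = {}"
    using assms(5) w p set_t(1) by simp
  have less: "\<forall>x\<in>set t \<union> set p. x < M"
  proof
    fix x assume "x \<in> set t \<union> set p"
    then have "x \<noteq> M" "x \<le> M"
      using set_t disj M_max by auto
    then show "x < M"
      by simp
  qed
  have pos: "\<forall>x\<in>set (M # t) \<union> set p. 0 < x"
    unfolding set_t(1) using w p by (auto simp: linear_perm_def)
  have p_ne: "p \<noteq> []"
    using len assms(2) by auto
  \<comment> \<open>Excludes a cyclic descent at the wrap-around, so \<open>cdes\<close> and
    \<open>des\<close> agree on the representative.\<close>
  have "last (M # t) \<le> M"
    using less by (cases "t = []") (auto simp: less_imp_le)
  then have r: "r = des (M # t)"
    using assms(6) \<sigma> by (simp add: cyc_cdes_rotation_class cdes_eq)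
  have maj_\<sigma>: "cyc_maj \<sigma> = maj (M # t)"
    using cyc_rep_Cons[OF set_t(2)] less \<sigma> by (simp add: cyc_maj_def less_imp_le)
  \<comment> \<open>The factors from \<open>gf_shuffles_Cons\<close> when the rotation has
    \<open>s\<close> descents (\<open>A\<close>) or \<open>s - 1\<close> descents
    (\<open>B\<close>).\<close>
  define A where "A = gauss (int m - int r + int s) (int k - int r)
        * gauss (int n - int s + int r - 1) (int k - int s - 1)
        * q powi (int (cyc_maj \<sigma>) + (int k - int s) * (int k - int r))"
  define B where "B = gauss (int m - int r + int s - 1) (int k - int r)
        * gauss (int n - int s + int r) (int k - int s)
        * q powi (int (cyc_maj \<sigma>) + (int k - int s + 1) * (int k - int r))"
  have summand: "q ^ k * gf (shuffles t (start_at i \<pi>)) (int k - 1) =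
      (if i \<in> cyc_cBd \<pi> then B else A) * q ^ maj (start_at i \<pi>)" if i: "i \<in> set p" for i
  proof -
    let ?S = "start_at i \<pi>"
    have S: "?S \<in> rotation_class p" "?S \<noteq> []" "hd ?S = i"
      using start_at_rotation_class[OF dist(2) i] p by auto
    have S': "set ?S = set p" "distinct ?S" "length ?S = n"
      using S dist len set_in_rotation_class distinct_in_rotation_class length_in_rotation_class
      by metis+
    have \<pi>: "\<pi> = rotation_class ?S"
      using rotation_class_eqI[OF S(1)] p by simp
    have "cyc_cBd \<pi> = cBd ?S" "s = cdes ?S"
      using \<pi> cyc_cBd_rotation_class[of ?S] cyc_cdes_rotation_class[of ?S] assms(7) by metis+
    then have "s = des ?S + (if i \<in> cyc_cBd \<pi> then 1 else 0)"
      using hd_in_cBd_iff[OF S'(2) S(2)] S by (simp add: cdes_eq)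
    moreover have "q powi int k * gf (shuffles t ?S) (int k - 1) =
        gauss (int m - int r + int (des ?S)) (int k - int r) *
        gauss (int n - int (des ?S) + int r - 1) (int k - int (des ?S) - 1) *
        q powi (int (cyc_maj \<sigma>) + (int k - int (des ?S)) * (int k - int r)) * q ^ maj ?S"
      unfolding r maj_\<sigma> set_t(3)[symmetric] S'(3)[symmetric]
      using disj less S S' by (intro gf_shuffles_Cons) auto
    ultimately show ?thesis
      by (simp add: A_def B_def algebra_simps split: if_splits)
  qed
  have "(\<Sum>\<alpha>\<in>{\<alpha>\<in>cyclic_shuffles \<sigma> \<pi>. cyc_cdes \<alpha> = k}. q ^ cyc_maj \<alpha>) =
      (\<Sum>i\<in>set p. (if i \<in> cyc_cBd \<pi> then B else A) * q ^ maj (start_at i \<pi>))"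
    unfolding \<sigma> p(2) sum_cyclic_shuffles_Cons[OF set_t(2) dist(2) p_ne disj pos less]
    using summand p(2) by (intro sum.cong) auto
  also have "\<dots> = (\<Sum>i\<in>set p \<inter> cyc_cBd \<pi>. B * q ^ maj (start_at i \<pi>)) +
      (\<Sum>i\<in>set p - cyc_cBd \<pi>. A * q ^ maj (start_at i \<pi>))"
    by (subst sum.Int_Diff[of _ _ "cyc_cBd \<pi>"]) (auto intro!: arg_cong2[of _ _ _ _ "(+)"] sum.cong)
  finally show ?thesis
    using p(2) by (simp add: A_def B_def sum_distrib_left)
qed

end
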